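(* Let $L$ be a vector subspace of $\mathbb R^n$ of dimension $l\ge 2$ not contained in any coordinate hyperplane, and let $\mathbb P=\{v\in\mathbb R^n: v_j>0 \text{ for all } j\}$ be the positive cone. Let $\mathbf 1:[n]\to\{-1,1\}$ be the constant function $j\mapsto 1$ and $\neg\mathbf 1$ the constant function $j\mapsto-1$. Then the following are equivalent: (1) $L$ intersects $\mathbb P$. (2) For all $g:[n]\to\{-1,1\}$ with $g\ne\mathbf 1,\neg\mathbf 1$, we have $\widetilde H^\bullet(\Xi(g);\Bbbk)=0$ as long as $\triangle_g\cap L\neq\emptyset$.
   Context: $[n]=\{0,\dots,n-1\}$ indexes the coordinates of $\mathbb R^n$; $\Bbbk$ is a fixed field. For $g:[n]\to\{-1,1\}$, $\triangle_g:=\{x\in S^{n-1}: g(j)x_j\ge 0\ \forall j\in[n]\}$ is the closed spherical simplex with sign pattern $g$ in the unit sphere $S^{n-1}\subset\mathbb R^n$. $\Xi(g)$ is the topological space $$\Xi(g):=L\cap\bigcup_{j:\,g(j)=1}\{x\in\triangle_g: x_j=0\},$$ i.e. the intersection with $L$ of the union of those facets of $\triangle_g$ lying in the hyperplanes $x_j=0$ with $g(j)=1$. $\widetilde H^\bullet$ is reduced cohomology in all degrees $\ge-1$, with the convention that the empty space (regarded as the complex having only the empty cell) has $\widetilde H^{-1}(\emptyset;\Bbbk)=\Bbbk\neq0$. *)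

theory Defs
  imports "HOL-Analysis.Analysis" "HOL-Homology.Homology"
begin

section \<open>Reduced singular cohomology with coefficients in a field\<close>

text \<open>
  HOL-Homology only provides integral homology, so cohomology is built here on its singular
  simplices. The cochain complex is augmented: in degree \<open>-1\<close> there is exactly one simplex, the
  empty one, encoded as the only extensional function on the empty set. It is present for every
  space, the empty space included.
\<close>

definition aug_simplex_set :: "int \<Rightarrow> 'a topology \<Rightarrow> ((nat \<Rightarrow> real) \<Rightarrow> 'a) set" where
  "aug_simplex_set p X =
     (if p \<ge> 0 then singular_simplex_set (nat p) X else if p = -1 then extensional {} else {})"

text \<open>The only face of a singular \<open>0\<close>-simplex is the empty simplex.\<close>

definition aug_face :: "int \<Rightarrow> nat \<Rightarrow> ((nat \<Rightarrow> real) \<Rightarrow> 'a) \<Rightarrow> (nat \<Rightarrow> real) \<Rightarrow> 'a" where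
  "aug_face p k f = (if p > 0 then singular_face (nat p) k f else (\<lambda>_. undefined))"

type_synonym ('a, 'k) cochain = "((nat \<Rightarrow> real) \<Rightarrow> 'a) \<Rightarrow> 'k"

definition cochain_group :: "int \<Rightarrow> 'a topology \<Rightarrow> ('a, 'k::field) cochain monoid" where
  "cochain_group p X =
     \<lparr>carrier = extensional (aug_simplex_set p X),
      mult = (\<lambda>c d. \<lambda>f \<in> aug_simplex_set p X. c f + d f),
      one = (\<lambda>f \<in> aug_simplex_set p X. 0)\<rparr>"

text \<open>
  The map from degree \<open>p\<close> to degree \<open>p + 1\<close>. For \<open>p = -1\<close> it sends a scalar to the corresponding
  constant \<open>0\<close>-cochain; for \<open>p < -1\<close> the sum is empty and the map is zero.
\<close>

definition coboundary ::
  "int \<Rightarrow> 'a topology \<Rightarrow> ('a, 'k::field) cochain \<Rightarrow> ('a, 'k) cochain" where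
  "coboundary p X c =
     (\<lambda>f \<in> aug_simplex_set (p + 1) X.
        \<Sum>k | int k \<le> p + 1. (-1) ^ k * c (aug_face (p + 1) k f))"

definition cocycle_set :: "int \<Rightarrow> 'a topology \<Rightarrow> ('a, 'k::field) cochain set" where
  "cocycle_set p X = kernel (cochain_group p X) (cochain_group (p + 1) X) (coboundary p X)"

definition coboundary_set :: "int \<Rightarrow> 'a topology \<Rightarrow> ('a, 'k::field) cochain set" where
  "coboundary_set p X = coboundary (p - 1) X ` carrier (cochain_group (p - 1) X)"

text \<open>
  The underlying additive group of the \<open>'k\<close>-vector space of cocycles modulo coboundaries.
\<close>

definition reduced_cohomology_group ::
  "int \<Rightarrow> 'a topology \<Rightarrow> ('a, 'k::field) cochain set monoid" where
  "reduced_cohomology_group p X =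
     (cochain_group p X)\<lparr>carrier := cocycle_set p X\<rparr> Mod coboundary_set p X"

text \<open>
  The field of coefficients is recorded in the type, so it has to be passed as a type argument.
\<close>

definition reduced_acyclic :: "'k::field itself \<Rightarrow> 'a topology \<Rightarrow> bool" where
  "reduced_acyclic _ X \<longleftrightarrow>
     (\<forall>p\<ge>-1. trivial_group (reduced_cohomology_group p X :: ('a, 'k) cochain set monoid))"


section \<open>Spherical simplices\<close>

text \<open>\<open>[n]\<close> is rendered by an arbitrary finite type \<open>'n\<close>.\<close>

definition spherical_simplex :: "('n::finite \<Rightarrow> int) \<Rightarrow> (real ^ 'n) set" where
  "spherical_simplex g = {x \<in> sphere 0 1. \<forall>j. of_int (g j) * x $ j \<ge> 0}"

definition Xi :: "(real ^ 'n) set \<Rightarrow> ('n::finite \<Rightarrow> int) \<Rightarrow> (real ^ 'n) topology" where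
  "Xi L g =
     subtopology euclidean (L \<inter> (\<Union>j \<in> {j. g j = 1}. {x \<in> spherical_simplex g. x $ j = 0}))"

definition positive_cone :: "(real ^ 'n::finite) set" where
  "positive_cone = {v. \<forall>j. v $ j > 0}"


section \<open>Sanity checks\<close>

lemma comm_group_cochain_group: "comm_group (cochain_group p X)"
proof (rule comm_groupI)
  fix c :: "('a, 'k::field) cochain"
  show "\<exists>y\<in>carrier (cochain_group p X). y \<otimes>\<^bsub>cochain_group p X\<^esub> c = \<one>\<^bsub>cochain_group p X\<^esub>"
    by (rule bexI[of _ "\<lambda>f \<in> aug_simplex_set p X. - c f"])
       (auto simp: cochain_group_def fun_eq_iff)
qed (auto simp: cochain_group_def restrict_def extensional_def fun_eq_iff algebra_simps)

lemma aug_face_in: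
  assumes "f \<in> aug_simplex_set p X" "int k \<le> p"
  shows "aug_face p k f \<in> aug_simplex_set (p - 1) X"
proof (cases "p > 0")
  case True
  with assms singular_simplex_singular_face[of "nat p" X f k] show ?thesis
    by (auto simp: aug_simplex_set_def aug_face_def nat_diff_distrib)
next
  case False
  with assms show ?thesis
    by (auto simp: aug_simplex_set_def aug_face_def extensional_def split: if_splits)
qed

lemma coboundary_hom:
  "coboundary p X \<in> hom (cochain_group p X) (cochain_group (p + 1) X)"
proof (rule homI)
  fix c d :: "('a, 'k::field) cochain"
  have "aug_face (p + 1) k f \<in> aug_simplex_set p X"
    if "f \<in> aug_simplex_set (p + 1) X" "int k \<le> p + 1" for f k
    using aug_face_in[OF that] by simp
  then show "coboundary p X (c \<otimes>\<^bsub>cochain_group p X\<^esub> d) =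
      coboundary p X c \<otimes>\<^bsub>cochain_group (p + 1) X\<^esub> coboundary p X d"
    by (auto simp: coboundary_def cochain_group_def fun_eq_iff restrict_def
        simp flip: sum.distrib distrib_left intro!: sum.cong)
qed (auto simp: coboundary_def cochain_group_def)

lemma aug_face_aug_face:
  assumes "i \<le> j" "int j < p"
  shows "aug_face (p - 1) i (aug_face p (Suc j) f) = aug_face (p - 1) j (aug_face p i f)"
proof (cases "p > 1")
  case True
  define q where "q = nat p"
  have q: "q \<ge> 2" "j \<le> q - Suc 0" "nat (p - 1) = q - Suc 0"
    using assms True by (auto simp: q_def)
  have "singular_face (q - Suc 0) i (singular_face q (Suc j) f) t =
        singular_face (q - Suc 0) j (singular_face q i f) t" for t
  proof (cases "t \<in> standard_simplex (q - Suc 0 - Suc 0)")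
    case True
    have "simplical_face i t \<in> standard_simplex (q - Suc 0)"
         "simplical_face j t \<in> standard_simplex (q - Suc 0)"
      using q True assms(1) by (auto intro!: simplical_face_in_standard_simplex)
    moreover have "simplical_face (Suc j) (simplical_face i t) = simplical_face i (simplical_face j t)"
      using assms(1) by (auto simp: simplical_face_def fun_eq_iff)
    ultimately show ?thesis
      using True by (simp add: singular_face_def)
  qed (simp add: singular_face_def)
  then show ?thesis
    using True q by (simp add: aug_face_def q_def fun_eq_iff)
qed (auto simp: aug_face_def)

lemma coboundary_coboundary:
  "coboundary (p + 1) X (coboundary p X c) = \<one>\<^bsub>cochain_group (p + 2) X\<^esub>"
proof -
  have "(\<Sum>k | int k \<le> p + 2. (-1) ^ k * coboundary p X c (aug_face (p + 2) k f)) = 0"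
    if f: "f \<in> aug_simplex_set (p + 2) X" for f
  proof (cases "p \<ge> -1")
    case False
    then have "coboundary p X c g = 0" if "g \<in> aug_simplex_set (p + 1) X" for g
      using that by (auto simp: coboundary_def intro!: sum.neutral)
    then show ?thesis
      using aug_face_in[OF f] by (intro sum.neutral) (auto simp: algebra_simps)
  next
    case True
    define m where "m = nat (p + 1)"
    have p: "p = int m - 1" using True by (simp add: m_def)
    define h where "h i j = c (aug_face (p + 1) j (aug_face (p + 2) i f))" for i j
    define A where "A = {..m} \<times> {..m}"
    have "(\<Sum>k | int k \<le> p + 2. (-1) ^ k * coboundary p X c (aug_face (p + 2) k f))
        = (\<Sum>i\<le>Suc m. \<Sum>j\<le>m. (-1) ^ (i + j) * h i j)"
    proof (rule sum.cong)
      show "{k. int k \<le> p + 2} = {..Suc m}" by (auto simp: p)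
    next
      fix i assume "i \<in> {..Suc m}"
      then have "aug_face (p + 2) i f \<in> aug_simplex_set (p + 1) X"
        using aug_face_in[OF f, of i] by (simp add: p)
      moreover have "{k. int k \<le> p + 1} = {..m}" by (auto simp: p)
      ultimately show "(-1) ^ i * coboundary p X c (aug_face (p + 2) i f)
          = (\<Sum>j\<le>m. (-1) ^ (i + j) * h i j)"
        by (simp add: coboundary_def h_def sum_distrib_left power_add mult.assoc)
    qed
    also have "\<dots> = (\<Sum>(i, j) \<in> {..Suc m} \<times> {..m}. (-1) ^ (i + j) * h i j)"
      by (simp add: sum.cartesian_product)
    also have "\<dots> = (\<Sum>(i, j) \<in> {(i, j). i \<le> j \<and> j \<le> m}. (-1) ^ (i + j) * h i j)
        + (\<Sum>(i, j) \<in> {(i, j). j < i \<and> i \<le> Suc m}. (-1) ^ (i + j) * h i j)"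
    proof -
      have fin: "finite {(i, j). i \<le> j \<and> j \<le> m}" "finite {(i, j). j < i \<and> i \<le> Suc m}"
        by (rule finite_subset[of _ "{..Suc m} \<times> {..Suc m}"]; auto)+
      have eq: "{..Suc m} \<times> {..m} = {(i, j). i \<le> j \<and> j \<le> m} \<union> {(i, j). j < i \<and> i \<le> Suc m}"
        by auto
      have "{(i, j). i \<le> j \<and> j \<le> m} \<inter> {(i, j). j < i \<and> i \<le> Suc m} = {}"
        by auto
      then show ?thesis
        unfolding eq by (rule sum.union_disjoint[OF fin])
    qed
    also have "(\<Sum>(i, j) \<in> {(i, j). j < i \<and> i \<le> Suc m}. (-1) ^ (i + j) * h i j)
        = (\<Sum>(i, j) \<in> {(i, j). i \<le> j \<and> j \<le> m}. - ((-1) ^ (i + j) * h i j))"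
    proof (rule sum.reindex_bij_witness[of _ "\<lambda>(i, j). (Suc j, i)" "\<lambda>(i, j). (j, i - 1)"], goal_cases)
      case (5 a)
      obtain i j where a: "a = (Suc i, j)" "j \<le> i" "i \<le> m"
        using 5 by (cases a; case_tac "fst a") auto
      have "h (Suc i) j = h j i"
        using aug_face_aug_face[of j i "p + 2" f] a by (simp add: h_def p)
      then show ?case
        using a by (simp add: add.commute)
    qed auto
    finally show ?thesis
      by (simp add: sum_negf case_prod_unfold)
  qed
  then show ?thesis
    by (auto simp: coboundary_def[of "p + 1"] cochain_group_def fun_eq_iff add.assoc)
qed

lemma coboundary_group_hom:
  "group_hom (cochain_group p X) (cochain_group (p + 1) X) (coboundary p X)"
  by (intro group_hom.intro group_hom_axioms.intro coboundary_hom
      comm_group.axioms(2) comm_group_cochain_group)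

lemma coboundary_set_subset: "coboundary_set p X \<subseteq> cocycle_set p X"
proof -
  have "coboundary (p - 1) X c \<in> carrier (cochain_group p X)" for c :: "('a, 'k::field) cochain"
    by (simp add: coboundary_def cochain_group_def)
  moreover have "coboundary p X (coboundary (p - 1) X c) = \<one>\<^bsub>cochain_group (p + 1) X\<^esub>"
    for c :: "('a, 'k::field) cochain"
    using coboundary_coboundary[of "p - 1" X c] by (simp add: add.commute)
  ultimately show ?thesis
    by (auto simp: coboundary_set_def cocycle_set_def kernel_def)
qed

lemma coboundary_set_normal:
  fixes p :: int and X :: "'a topology"
  defines "C \<equiv> (cochain_group p X :: ('a, 'k::field) cochain monoid)"
  shows "coboundary_set p X \<lhd> C\<lparr>carrier := cocycle_set p X\<rparr>"
proof -
  interpret G: comm_group C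
    unfolding C_def by (rule comm_group_cochain_group)
  have Z: "subgroup (cocycle_set p X) C"
    unfolding C_def cocycle_set_def by (rule group_hom.subgroup_kernel[OF coboundary_group_hom])
  interpret D: group_hom "cochain_group (p - 1) X :: ('a, 'k) cochain monoid" C "coboundary (p - 1) X"
    using coboundary_group_hom[of "p - 1" X] by (simp add: C_def)
  have "subgroup (coboundary_set p X) C"
    unfolding coboundary_set_def by (rule D.img_is_subgroup)
  then have "subgroup (coboundary_set p X) (C\<lparr>carrier := cocycle_set p X\<rparr>)"
    using G.subgroup_incl Z coboundary_set_subset by blast
  moreover have "comm_group (C\<lparr>carrier := cocycle_set p X\<rparr>)"
    using G.subgroup_imp_group[OF Z] subgroup.subset[OF Z]
    by (intro group.group_comm_groupI) (auto intro: G.m_comm)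
  ultimately show ?thesis
    by (simp add: comm_group.subgroup_imp_normal)
qed

lemma group_reduced_cohomology_group: "group (reduced_cohomology_group p X)"
  unfolding reduced_cohomology_group_def by (rule normal.factorgroup_is_group[OF coboundary_set_normal])

lemma trivial_reduced_cohomology_group_iff:
  fixes X :: "'a topology"
  shows "trivial_group (reduced_cohomology_group p X :: ('a, 'k::field) cochain set monoid) \<longleftrightarrow>
    (cocycle_set p X :: ('a, 'k) cochain set) = coboundary_set p X"
proof -
  define Z where "Z = (cochain_group p X :: ('a, 'k) cochain monoid)\<lparr>carrier := cocycle_set p X\<rparr>"
  define B where "B = (coboundary_set p X :: ('a, 'k) cochain set)"
  interpret N: normal B Z
    unfolding B_def Z_def by (rule coboundary_set_normal)
  have "trivial_group (Z Mod B) \<longleftrightarrow> carrier Z = B"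
  proof
    assume "trivial_group (Z Mod B)"
    then have triv: "rcosets\<^bsub>Z\<^esub> B = {B}"
      by (simp add: trivial_group_def FactGroup_def)
    have "c \<in> B" if c: "c \<in> carrier Z" for c
      using N.rcos_self[OF c N.is_subgroup] N.rcosetsI[OF N.subset c] triv by simp
    then show "carrier Z = B"
      using N.subset by blast
  next
    assume "carrier Z = B"
    then have "rcosets\<^bsub>Z\<^esub> B = {B}"
      using N.coset_join2[OF _ N.is_subgroup] N.one_closed by (auto simp: RCOSETS_def)
    then show "trivial_group (Z Mod B)"
      using N.factorgroup_is_group by (simp add: trivial_group_def FactGroup_def)
  qed
  then show ?thesis
    by (simp add: reduced_cohomology_group_def Z_def B_def)
qed

lemma reduced_cohomology_empty_space:
  fixes X :: "'a topology"
  assumes "topspace X = {}"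
  shows "\<not> trivial_group (reduced_cohomology_group (-1) X :: ('a, 'k::field) cochain set monoid)"
proof -
  let ?c = "(\<lambda>f \<in> aug_simplex_set (-1) X. 1) :: ('a, 'k) cochain"
  let ?e = "\<lambda>_::nat \<Rightarrow> real. undefined"
  have e: "?e \<in> aug_simplex_set (-1) X"
    by (simp add: aug_simplex_set_def extensional_def)
  have "aug_simplex_set 0 X = {}"
    using singular_simplex_empty[OF assms] by (auto simp: aug_simplex_set_def)
  then have "?c \<in> cocycle_set (-1) X"
    by (simp add: cocycle_set_def kernel_def cochain_group_def coboundary_def fun_eq_iff)
  moreover have "d ?e = 0" if "d \<in> coboundary_set (-1) X" for d :: "('a, 'k) cochain"
    using that e by (auto simp: coboundary_set_def coboundary_def)
  then have "?c \<notin> coboundary_set (-1) X"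
    using e by fastforce
  ultimately show ?thesis
    by (auto simp: trivial_reduced_cohomology_group_iff)
qed

end

theory Submission
  imports Defs
begin

text \<open>
  Write \<open>C\<^sub>g\<close> for the cone of all \<open>x \<in> L\<close> with \<open>g j * x\<^sub>j \<ge> 0\<close> for every \<open>j\<close>. It contains no line, and
  \<open>\<Xi>(g)\<close> consists of the unit vectors of \<open>C\<^sub>g\<close> on which some coordinate with \<open>g j = 1\<close> vanishes.

  Suppose that \<open>L\<close> contains a positive vector \<open>p\<close> and that \<open>g\<close> takes both signs. Starting at a
  nonzero \<open>x \<in> C\<^sub>g\<close>, move in direction \<open>-p\<close> until the first coordinate with \<open>g j = 1\<close> reaches \<open>0\<close>.
  The coordinates with \<open>g j = -1\<close> only become more negative, so the point stays in \<open>C\<^sub>g\<close>, and it cannot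
  reach the origin. After normalization this retracts the convex set \<open>C\<^sub>g - {0}\<close> onto \<open>\<Xi>(g)\<close>
  (\<open>Xi_set_retract_of\<close>). A retract of a nonempty convex set is acyclic, because coning off simplices
  and then retracting is a contracting homotopy (\<open>reduced_acyclic_retract_of_convex\<close>).

  Suppose that \<open>L\<close> contains no positive vector. Among the points of \<open>L\<close> with no vanishing
  coordinate choose one, \<open>v\<close>, with as many positive coordinates as possible, and let \<open>g\<close> be its sign
  vector, which is not constant. Let \<open>x \<in> C\<^sub>g\<close> have a vanishing coordinate. If all its vanishing
  coordinates had \<open>g j = -1\<close>, then \<open>x - \<epsilon> v\<close> would have more positive coordinates than \<open>v\<close>. Hence
  \<open>\<Xi>(g)\<close> is the entire boundary of \<open>C\<^sub>g\<close>, cut with the unit sphere (\<open>maximal_chamber\<close>). The projection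
  of \<open>L\<close> along the interior point \<open>v\<close> maps it homeomorphically to the unit sphere of a hyperplane of
  \<open>L\<close> (\<open>sign_cone_boundary_homeomorphic_sphere\<close>), which is nonempty because \<open>dim L \<ge> 2\<close>. A sphere is
  not acyclic over any field. This is derived from its integral homology by the part of the
  universal coefficient theorem which says that a class generating the first nonvanishing homology
  group, if that group is infinite cyclic, is detected by a cocycle
  (\<open>not_reduced_acyclic_of_integral_class\<close>).
\<close>

section \<open>Retracts of convex sets are acyclic\<close>

lemma reduced_acyclic_iff_cocycle_set_eq:
  fixes X :: "'a topology"
  shows "reduced_acyclic TYPE('k::field) X \<longleftrightarrow>
    (\<forall>p\<ge>-1. (cocycle_set p X :: ('a, 'k) cochain set) = coboundary_set p X)"
  by (simp add: reduced_acyclic_def trivial_reduced_cohomology_group_iff)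

text \<open>
  The join of the vertex \<open>a\<close> with the simplex \<open>f\<close>, followed by a map \<open>r\<close>. At \<open>t 0 = 1\<close> the argument of \<open>f\<close>
  is meaningless, but its value has coefficient \<open>0\<close>. The same happens for \<open>p = -1\<close>, where the cone over
  the empty simplex is the constant simplex at \<open>r a\<close>, so that the augmentation needs no separate case.
\<close>

definition cone_simplex ::
  "('a::real_normed_vector \<Rightarrow> 'b) \<Rightarrow> 'a \<Rightarrow> int \<Rightarrow> ((nat \<Rightarrow> real) \<Rightarrow> 'a) \<Rightarrow> (nat \<Rightarrow> real) \<Rightarrow> 'b" where
  "cone_simplex r a p f =
     (\<lambda>t \<in> standard_simplex (nat (p + 1)).
        r (t 0 *\<^sub>R a + (1 - t 0) *\<^sub>R f (\<lambda>i. t (Suc i) / (1 - t 0))))"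

lemma standard_simplex_project_from_vertex:
  assumes t: "t \<in> standard_simplex (Suc q)" and "t 0 \<noteq> 1"
  shows "(\<lambda>i. t (Suc i) / (1 - t 0)) \<in> standard_simplex q"
proof -
  have nonneg: "0 \<le> t i" for i using t by (auto simp: standard_simplex_def)
  have lt: "t 0 < 1" using t \<open>t 0 \<noteq> 1\<close> by (auto simp: standard_simplex_def order.strict_iff_order)
  have sum: "(\<Sum>i\<le>q. t (Suc i)) = 1 - t 0"
    using t unfolding standard_simplex_def sum.atMost_Suc_shift by simp
  have le: "t (Suc i) \<le> 1 - t 0" for i
  proof (cases "i \<le> q")
    case True
    then show ?thesis
      using member_le_sum[of i "{..q}" "\<lambda>i. t (Suc i)"] nonneg sum by simp
  next
    case False
    then show ?thesis using t lt by (auto simp: standard_simplex_def)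
  qed
  show ?thesis
    using t nonneg lt le sum
    by (auto simp: standard_simplex_def simp flip: sum_divide_distrib)
qed

text \<open>
  Only continuity at the vertex \<open>t 0 = 1\<close> is delicate: there the argument of \<open>f\<close> has in general no limit, but \<open>f\<close> is
  bounded on its compact domain and the factor \<open>1 - t 0\<close> tends to \<open>0\<close>.
\<close>

lemma continuous_on_cone:
  fixes f :: "(nat \<Rightarrow> real) \<Rightarrow> 'a::real_normed_vector"
  assumes f: "continuous_on (standard_simplex q) f"
  shows "continuous_on (standard_simplex (Suc q))
    (\<lambda>t. t 0 *\<^sub>R a + (1 - t 0) *\<^sub>R f (\<lambda>i. t (Suc i) / (1 - t 0)))"
proof -
  let ?D = "standard_simplex (Suc q)"
  let ?s = "\<lambda>t::nat \<Rightarrow> real. \<lambda>i. t (Suc i) / (1 - t 0)"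
  have coord: "continuous_on A (\<lambda>t::nat \<Rightarrow> real. t i)" for A i
    by (rule continuous_on_product_coordinates[THEN continuous_on_subset]) simp
  have "compact (standard_simplex q)"
    using compactin_standard_simplex[of q] by (simp add: euclidean_product_topology)
  then have "bounded (f ` standard_simplex q)"
    using f compact_continuous_image compact_imp_bounded by blast
  then obtain M where M: "\<And>t. t \<in> standard_simplex q \<Longrightarrow> norm (f t) \<le> M"
    by (auto simp: bounded_iff)
  have "continuous_on ?D (\<lambda>t. (1 - t 0) *\<^sub>R f (?s t))"
    unfolding continuous_on_eq_continuous_within
  proof
    fix t assume t: "t \<in> ?D"
    show "continuous (at t within ?D) (\<lambda>t. (1 - t 0) *\<^sub>R f (?s t))"
    proof (cases "t 0 = 1")
      case True
      have bound: "norm ((1 - u 0) *\<^sub>R f (?s u)) \<le> (1 - u 0) * M" if "u \<in> ?D" for u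
      proof (cases "u 0 = 1")
        case False
        then show ?thesis
          using M[OF standard_simplex_project_from_vertex[OF that False]] that
          by (simp add: standard_simplex_def mult_left_mono)
      qed simp
      have "((\<lambda>u. (1 - u 0) * M) \<longlongrightarrow> (1 - t 0) * M) (at t within ?D)"
        using coord[of ?D 0] t unfolding continuous_on_def by (intro tendsto_intros) auto
      then have "((\<lambda>u. (1 - u 0) * M) \<longlongrightarrow> 0) (at t within ?D)"
        by (simp add: True)
      then have "((\<lambda>u. (1 - u 0) *\<^sub>R f (?s u)) \<longlongrightarrow> 0) (at t within ?D)"
        by (rule Lim_null_comparison[rotated])
          (auto simp: eventually_at_filter bound simp del: norm_scaleR)
      then show ?thesis
        by (simp add: continuous_within True)
    next
      case False
      let ?E = "?D \<inter> {u. u 0 \<noteq> 1}"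
      have "continuous_on ?E ?s"
        by (rule continuous_on_coordinatewise_then_product) (intro continuous_intros coord; simp)
      then have "continuous_on ?E (\<lambda>u. (1 - u 0) *\<^sub>R f (?s u))"
        by (intro continuous_intros coord continuous_on_compose2[OF f])
          (auto intro: standard_simplex_project_from_vertex)
      then have "continuous (at t within ?E) (\<lambda>u. (1 - u 0) *\<^sub>R f (?s u))"
        using t False by (simp add: continuous_on_eq_continuous_within)
      moreover have "open {u::nat \<Rightarrow> real. u 0 \<noteq> 1}"
        by (intro open_Collect_neq coord continuous_on_const)
      then have "at t within ?E = at t within ?D"
        by (intro at_within_nhd[of t "{u. u 0 \<noteq> 1}"]) (use False in auto)
      ultimately show ?thesis by simp
    qed
  qed
  then show ?thesis
    by (rule continuous_on_add[rotated]) (intro continuous_intros coord)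
qed

lemma singular_simplex_top_of_set:
  "singular_simplex q (top_of_set S) f \<longleftrightarrow>
    continuous_on (standard_simplex q) f \<and> f ` standard_simplex q \<subseteq> S \<and>
    f \<in> extensional (standard_simplex q)"
  by (auto simp: singular_simplex_def euclidean_product_topology)

lemma cone_simplex_in:
  fixes C :: "'a::real_normed_vector set" and S :: "'b::topological_space set"
  assumes "convex C" "a \<in> C" "T \<subseteq> C" and r: "continuous_on C r" "r \<in> C \<rightarrow> S"
    and f: "f \<in> aug_simplex_set p (top_of_set T)" and "p \<ge> -1"
  shows "cone_simplex r a p f \<in> aug_simplex_set (p + 1) (top_of_set S)"
proof -
  let ?h = "\<lambda>t. t 0 *\<^sub>R a + (1 - t 0) *\<^sub>R f (\<lambda>i. t (Suc i) / (1 - t 0))"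
  let ?D = "standard_simplex (nat (p + 1))"
  have "continuous_on ?D ?h \<and> ?h ` ?D \<subseteq> C"
  proof (cases "p = -1")
    case True
    then show ?thesis
      using \<open>a \<in> C\<close> by (auto simp: standard_simplex_0)
  next
    case False
    define q where "q = nat p"
    have q: "nat (p + 1) = Suc q"
      using False \<open>p \<ge> -1\<close> by (simp add: q_def nat_add_distrib)
    have f: "continuous_on (standard_simplex q) f" "f ` standard_simplex q \<subseteq> T"
      using f False \<open>p \<ge> -1\<close>
      by (auto simp: aug_simplex_set_def singular_simplex_top_of_set q_def)
    have "?h t \<in> C" if t: "t \<in> ?D" for t
    proof (cases "t 0 = 1")
      case False
      then have "f (\<lambda>i. t (Suc i) / (1 - t 0)) \<in> C"
        using standard_simplex_project_from_vertex[of t q] t f(2) \<open>T \<subseteq> C\<close> by (auto simp: q)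
      moreover have "0 \<le> t 0" "t 0 \<le> 1" using t by (auto simp: standard_simplex_def)
      ultimately show ?thesis
        using \<open>convex C\<close> \<open>a \<in> C\<close> by (simp add: convexD)
    qed (use \<open>a \<in> C\<close> in simp)
    then show ?thesis
      using continuous_on_cone[OF f(1)] by (auto simp: q)
  qed
  then have "continuous_on ?D (\<lambda>t. r (?h t))" "(\<lambda>t. r (?h t)) ` ?D \<subseteq> S"
    using r by (auto intro: continuous_on_compose2)
  then show ?thesis
    using \<open>p \<ge> -1\<close>
    by (auto simp: aug_simplex_set_def singular_simplex_top_of_set cone_simplex_def
        cong: continuous_on_cong)
qed

lemma aug_face_0_cone_simplex:
  assumes f: "f \<in> aug_simplex_set p (top_of_set S)" and "p \<ge> -1" and r: "\<And>x. x \<in> S \<Longrightarrow> r x = x"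
  shows "aug_face (p + 1) 0 (cone_simplex r a p f) = f"
proof (cases "p = -1")
  case True
  then show ?thesis
    using f by (auto simp: aug_face_def aug_simplex_set_def extensional_def)
next
  case False
  then have p: "p \<ge> 0" "nat (p + 1) = Suc (nat p)" using \<open>p \<ge> -1\<close> by (auto simp: nat_add_distrib)
  then have f: "f ` standard_simplex (nat p) \<subseteq> S" "f \<in> extensional (standard_simplex (nat p))"
    using f by (auto simp: aug_simplex_set_def singular_simplex_top_of_set)
  have "cone_simplex r a p f (simplical_face 0 t) = f t" if "t \<in> standard_simplex (nat p)" for t
    using simplical_face_in_standard_simplex[of "Suc (nat p)" 0 t] that f r p
    by (auto simp: cone_simplex_def simplical_face_def)
  then show ?thesis
    using p f by (auto simp: aug_face_def singular_face_def fun_eq_iff extensional_def)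
qed

lemma aug_face_Suc_cone_simplex:
  assumes "int k \<le> p"
  shows "aug_face (p + 1) (Suc k) (cone_simplex r a p f) =
    cone_simplex r a (p - 1) (aug_face p k f)"
proof
  fix t
  have p: "p \<ge> 0" "nat (p + 1) = Suc (nat p)" "k \<le> nat p" using assms by (auto simp: nat_add_distrib)
  show "aug_face (p + 1) (Suc k) (cone_simplex r a p f) t = cone_simplex r a (p - 1) (aug_face p k f) t"
  proof (cases "t \<in> standard_simplex (nat p)")
    case True
    define u where "u = simplical_face (Suc k) t"
    have u: "u \<in> standard_simplex (Suc (nat p))"
      using simplical_face_in_standard_simplex[of "Suc (nat p)" "Suc k" t] True p by (simp add: u_def)
    have u0: "u 0 = t 0" by (simp add: u_def simplical_face_def)
    have us: "(\<lambda>i. u (Suc i) / (1 - t 0)) = simplical_face k (\<lambda>i. t (Suc i) / (1 - t 0))"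
    proof
      fix i show "u (Suc i) / (1 - t 0) = simplical_face k (\<lambda>i. t (Suc i) / (1 - t 0)) i"
        by (cases i) (auto simp: u_def simplical_face_def)
    qed
    have "f (\<lambda>i. u (Suc i) / (1 - t 0)) = aug_face p k f (\<lambda>i. t (Suc i) / (1 - t 0))" if "t 0 \<noteq> 1"
    proof -
      have "p > 0"
        using True that by (cases "p = 0") (use p in \<open>auto simp: standard_simplex_0\<close>)
      then have "t \<in> standard_simplex (Suc (nat p - Suc 0))" using True by simp
      then show ?thesis
        using standard_simplex_project_from_vertex[of t "nat p - Suc 0"] that \<open>p > 0\<close>
        by (auto simp: us aug_face_def singular_face_def)
    qed
    then have "u 0 *\<^sub>R a + (1 - u 0) *\<^sub>R f (\<lambda>i. u (Suc i) / (1 - u 0)) =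
       t 0 *\<^sub>R a + (1 - t 0) *\<^sub>R aug_face p k f (\<lambda>i. t (Suc i) / (1 - t 0))"
      unfolding u0 by (cases "t 0 = 1") auto
    then show ?thesis
      using True p u by (simp add: aug_face_def singular_face_def cone_simplex_def flip: u_def)
  next
    case False
    then show ?thesis
      using p by (simp add: aug_face_def singular_face_def cone_simplex_def)
  qed
qed

text \<open>
  Let \<open>K\<close> be the operation that cones a simplex of \<open>S\<close> off inside \<open>C\<close> and pushes the result back into
  \<open>S\<close> by the retraction. The two face formulas say that \<open>\<partial> K + K \<partial> = id\<close> in every degree of the augmented
  complex, so a cocycle \<open>c\<close> is the coboundary of \<open>c \<circ> K\<close>.
\<close>

lemma reduced_acyclic_retract_of_convex:
  fixes C S :: "'a::real_normed_vector set"
  assumes "convex C" "C \<noteq> {}" "S retract_of C"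
  shows "reduced_acyclic TYPE('k::field) (top_of_set S)"
  unfolding reduced_acyclic_iff_cocycle_set_eq
proof (intro allI impI antisym coboundary_set_subset subsetI)
  fix p :: int and c :: "('a, 'k) cochain"
  let ?X = "top_of_set S"
  assume "p \<ge> -1" and "c \<in> cocycle_set p ?X"
  then have ext: "c \<in> extensional (aug_simplex_set p ?X)"
    and zero: "\<And>f. f \<in> aug_simplex_set (p + 1) ?X \<Longrightarrow>
      (\<Sum>k | int k \<le> p + 1. (-1) ^ k * c (aug_face (p + 1) k f)) = 0"
    by (auto simp: cocycle_set_def kernel_def cochain_group_def coboundary_def restrict_def fun_eq_iff
        dest: spec split: if_splits)
  obtain r where r: "S \<subseteq> C" "continuous_on C r" "r \<in> C \<rightarrow> S" "\<And>x. x \<in> S \<Longrightarrow> r x = x"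
    using \<open>S retract_of C\<close> by (auto simp: retract_of_def retraction_def)
  obtain a where a: "a \<in> C" using \<open>C \<noteq> {}\<close> by blast
  define e where "e = (\<lambda>f \<in> aug_simplex_set (p - 1) ?X. c (cone_simplex r a (p - 1) f))"
  have "coboundary (p - 1) ?X e f = c f" for f
  proof (cases "f \<in> aug_simplex_set p ?X")
    case True
    let ?F = "\<lambda>k. (-1) ^ k * c (aug_face (p + 1) k (cone_simplex r a p f))"
    have "{k. int k \<le> p + 1} = insert 0 (Suc ` {k. int k \<le> p})"
      using \<open>p \<ge> -1\<close> by (auto simp: image_iff gr0_conv_Suc) (metis not0_implies_Suc of_nat_Suc add_le_cancel_right add.commute)
    moreover have "finite {k. int k \<le> p}"
      by (rule finite_subset[of _ "{..nat p}"]) auto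
    ultimately have "(\<Sum>k | int k \<le> p + 1. ?F k) = ?F 0 + (\<Sum>k | int k \<le> p. ?F (Suc k))"
      by (simp add: sum.reindex)
    also have "?F 0 = c f"
      using aug_face_0_cone_simplex[OF True \<open>p \<ge> -1\<close> r(4)] by simp
    also have "(\<Sum>k | int k \<le> p. ?F (Suc k)) = (\<Sum>k | int k \<le> p. - ((-1) ^ k * e (aug_face p k f)))"
      using aug_face_in[OF True]
      by (intro sum.cong) (auto simp: aug_face_Suc_cone_simplex e_def)
    finally have "c f = (\<Sum>k | int k \<le> p. (-1) ^ k * e (aug_face p k f))"
      using zero[OF cone_simplex_in[OF \<open>convex C\<close> a r(1-3) True \<open>p \<ge> -1\<close>]]
      by (simp add: sum_negf)
    then show ?thesis
      using True by (simp add: coboundary_def)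
  next
    case False
    then show ?thesis
      using ext by (simp add: coboundary_def extensional_def)
  qed
  then have "c = coboundary (p - 1) ?X e" by (simp add: fun_eq_iff)
  then show "c \<in> coboundary_set p ?X"
    by (auto simp: coboundary_set_def cochain_group_def e_def)
qed

section \<open>Spheres are not acyclic over any field\<close>

text \<open>
  In degree \<open>0\<close> the map to a point computes the augmentation, that is, the sum of the coefficients.
\<close>

definition reduced_cycle :: "nat \<Rightarrow> 'a topology \<Rightarrow> 'a chain \<Rightarrow> bool" where
  "reduced_cycle p X z \<longleftrightarrow>
     singular_relcycle p X {} z \<and> (p = 0 \<longrightarrow> chain_map 0 (\<lambda>_. ()) z = 0)"

lemma reduced_cycle_diff:
  "reduced_cycle p X a \<Longrightarrow> reduced_cycle p X b \<Longrightarrow> reduced_cycle p X (a - b)"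
  by (simp add: reduced_cycle_def singular_relcycle_diff chain_map_diff)

lemma carrier_reduced_homology_group_eq:
  "carrier (reduced_homology_group (int p) X) =
     homologous_rel_set p X {} ` Collect (reduced_cycle p X)"
proof (cases "p = 0")
  case False
  then show ?thesis
    by (simp add: un_reduced_homology_group carrier_relative_homology_group reduced_cycle_def[abs_def])
next
  case True
  let ?U = "discrete_topology {()}"
  have "hom_induced 0 X {} ?U {} (\<lambda>x. ()) (homologous_rel_set 0 X {} z) = \<one>\<^bsub>homology_group 0 ?U\<^esub>
      \<longleftrightarrow> chain_map 0 (\<lambda>_. ()) z = 0" if z: "singular_relcycle 0 X {} z" for z
  proof -
    have "hom_induced (int 0) X {} ?U {} (\<lambda>x. ()) (homologous_rel_set 0 X {} z) =
        homologous_rel_set 0 ?U {} (chain_map 0 (\<lambda>_. ()) z)"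
      by (rule hom_induced_chain_map) (use z in auto)
    moreover have "singular_relboundary 0 ?U {} (chain_map 0 (\<lambda>_. ()) z) \<longleftrightarrow> chain_map 0 (\<lambda>_. ()) z = 0"
      by (subst singular_boundary_singleton) (use z in \<open>auto simp: singular_cycle
          intro: singular_chain_chain_map\<close>)
    ultimately show ?thesis
      using one_relative_homology_group[of 0 ?U "{}"]
      by (simp add: homologous_rel_set_eq_relboundary)
  qed
  then have "{c \<in> homologous_rel_set 0 X {} ` singular_relcycle_set 0 X {}.
        hom_induced 0 X {} ?U {} (\<lambda>x. ()) c = \<one>\<^bsub>homology_group 0 ?U\<^esub>} =
      homologous_rel_set 0 X {} ` Collect (reduced_cycle 0 X)"
    unfolding reduced_cycle_def by blast
  then show ?thesis
    by (simp add: True carrier_reduced_homology_group kernel_def carrier_relative_homology_group_0)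
qed

text \<open>
  In degree \<open>0\<close> this holds because a \<open>1\<close>-chain in a one-point space has zero boundary.
\<close>

lemma reduced_cycle_boundary:
  assumes "singular_chain (Suc p) X c"
  shows "reduced_cycle p X (chain_boundary (Suc p) c)"
proof -
  have "chain_map 0 (\<lambda>_. ()) (chain_boundary (Suc 0) c) = 0" if c: "singular_chain (Suc 0) X c"
  proof -
    have "chain_boundary (Suc 0) (chain_map (Suc 0) (\<lambda>_. ()) c) = 0"
      by (subst chain_boundary_of_singleton[of "discrete_topology {()}" "()"])
        (auto intro: singular_chain_chain_map[OF c])
    then show ?thesis
      using chain_boundary_chain_map[OF c, of "\<lambda>_. ()"] by simp
  qed
  then show ?thesis
    using assms singular_chain_boundary_alt[OF assms] chain_boundary_boundary_alt[OF assms]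
    by (auto simp: reduced_cycle_def singular_cycle)
qed

lemma trivial_reduced_homology_group_imp_boundary:
  assumes "trivial_group (reduced_homology_group (int p) X)" and "reduced_cycle p X z"
  shows "singular_relboundary p X {} z"
proof -
  have "homologous_rel_set p X {} z \<in> carrier (reduced_homology_group (int p) X)"
    using assms(2) by (auto simp: carrier_reduced_homology_group_eq)
  then have "homologous_rel_set p X {} z = singular_relboundary_set p X {}"
    using assms(1) one_relative_homology_group[of p X "{}"]
    by (simp add: trivial_group_def one_reduced_homology_group)
  then show ?thesis
    by (simp add: homologous_rel_set_eq_relboundary)
qed

lemma homologous_rel_set_add:
  assumes "reduced_cycle p X a" "reduced_cycle p X b"
  shows "homologous_rel_set p X {} (a + b) =
    homologous_rel_set p X {} a \<otimes>\<^bsub>reduced_homology_group (int p) X\<^esub> homologous_rel_set p X {} b"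
proof -
  have "homologous_rel_set p X {} (a + b) =
    (\<Union>r\<in>homologous_rel_set p X {} a. \<Union>s\<in>homologous_rel_set p X {} b. {r + s})"
  proof (intro equalityI subsetI)
    fix x assume x: "x \<in> homologous_rel_set p X {} (a + b)"
    then have "homologous_rel p X {} b (x - a)"
      by (simp add: homologous_rel_def algebra_simps)
    then show "x \<in> (\<Union>r\<in>homologous_rel_set p X {} a. \<Union>s\<in>homologous_rel_set p X {} b. {r + s})"
      by (intro UN_I[of a] UN_I[of "x - a"]) auto
  qed (auto intro: homologous_rel_add)
  then show ?thesis
    by (simp add: reduced_homology_group_def mult_relative_homology_group)
qed

lemma chain_additive_eqI:
  assumes "singular_chain p X c"
    and "\<And>a b. F (a - b) = F a - F b" "\<And>a b. G (a - b) = G a - G b"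
    and "\<And>f. singular_simplex p X f \<Longrightarrow> F (frag_of f) = G (frag_of f)"
  shows "(F c :: 'b::ab_group_add) = G c"
proof -
  have z: "F 0 = 0" "G 0 = 0" using assms(2)[of 0 0] assms(3)[of 0 0] by auto
  show ?thesis
    using assms(1) unfolding singular_chain_def
    by (induction c rule: frag_induction) (auto simp: z assms(2-4))
qed

text \<open>
  The reduced cycles are a direct summand of the chains as long as there is no reduced homology below.
  In degree \<open>0\<close> subtract from each point a fixed base point. Given a retraction \<open>r\<close> in degree \<open>p\<close>, each
  \<open>r f\<close> is a reduced cycle, hence the boundary of some chain \<open>s f\<close>; extend \<open>s\<close> linearly over the free
  group of chains. Then \<open>\<partial> s = r\<close>, and \<open>id - s \<partial>\<close> is a retraction in degree \<open>p + 1\<close>. This replaces the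
  freeness of the group of boundaries in the universal coefficient theorem.
\<close>

lemma additive_retraction_onto_reduced_cycles:
  fixes X :: "'a topology"
  assumes "\<And>i. i < p \<Longrightarrow> trivial_group (reduced_homology_group (int i) X)" and "topspace X \<noteq> {}"
  shows "\<exists>r. (\<forall>a b. r (a - b) = r a - r b) \<and>
    (\<forall>c. singular_chain p X c \<longrightarrow> reduced_cycle p X (r c)) \<and>
    (\<forall>z. reduced_cycle p X z \<longrightarrow> r z = z)"
  using assms(1)
proof (induction p)
  case 0
  obtain x where x: "x \<in> topspace X" using \<open>topspace X \<noteq> {}\<close> by blast
  define f0 where "f0 = (\<lambda>t\<in>standard_simplex 0. x)"
  have f0: "singular_simplex 0 X f0"
    using x by (simp add: singular_simplex_def f0_def)
  have pt: "simplex_map 0 (\<lambda>_. ()) f = simplex_map 0 (\<lambda>_. ()) g" for f g :: "(nat \<Rightarrow> real) \<Rightarrow> 'a"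
    by (simp add: simplex_map_def)
  define aug where "aug = frag_extend (\<lambda>_::(nat \<Rightarrow> real) \<Rightarrow> 'a. frag_of f0)"
  have aug: "aug z = frag_extend (\<lambda>_. frag_of f0) (chain_map 0 (\<lambda>_. ()) z)" for z :: "'a chain"
    unfolding aug_def chain_map_def by (subst frag_extend_compose) (simp add: o_def)
  define r where "r c = c - aug c" for c :: "'a chain"
  have "reduced_cycle 0 X (r c)" if c: "singular_chain 0 X c" for c
  proof -
    have "singular_chain 0 X (aug c)"
      unfolding aug_def by (rule singular_chain_extend) (simp add: singular_chain_of f0)
    moreover have "chain_map 0 (\<lambda>_. ()) (aug c) = chain_map 0 (\<lambda>_. ()) c"
      by (rule chain_additive_eqI[OF c])
        (auto simp: aug_def frag_extend_diff chain_map_diff intro!: arg_cong[of _ _ frag_of] pt)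
    ultimately show ?thesis
      using c by (auto simp: reduced_cycle_def r_def singular_cycle singular_chain_diff chain_map_diff
          chain_boundary_def)
  qed
  moreover have "r z = z" if "reduced_cycle 0 X z" for z
    using that by (simp add: reduced_cycle_def r_def aug)
  moreover have "r (a - b) = r a - r b" for a b
    by (simp add: r_def aug_def frag_extend_diff)
  ultimately show ?case by (intro exI[of _ r]) auto
next
  case (Suc p)
  obtain r where r: "\<And>a b. r (a - b) = r a - r b" "\<And>c. singular_chain p X c \<Longrightarrow> reduced_cycle p X (r c)"
    "\<And>z. reduced_cycle p X z \<Longrightarrow> r z = z"
    using Suc.IH Suc.prems by (metis less_SucI)
  have "\<exists>d. singular_chain (Suc p) X d \<and> chain_boundary (Suc p) d = r (frag_of f)"
    if f: "singular_simplex p X f" for f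
    using trivial_reduced_homology_group_imp_boundary[OF Suc.prems[of p] r(2)] f
    by (simp add: singular_boundary singular_chain_of)
  then obtain s where s: "\<And>f. singular_simplex p X f \<Longrightarrow> singular_chain (Suc p) X (s f)"
      "\<And>f. singular_simplex p X f \<Longrightarrow> chain_boundary (Suc p) (s f) = r (frag_of f)"
    by metis
  have bd: "chain_boundary (Suc p) (frag_extend s c) = r c" if "singular_chain p X c" for c
    using that by (rule chain_additive_eqI)
      (simp_all add: frag_extend_diff chain_boundary_diff r(1) s(2))
  define r' where "r' c = c - frag_extend s (chain_boundary (Suc p) c)" for c
  have "reduced_cycle (Suc p) X (r' c)" if c: "singular_chain (Suc p) X c" for c
  proof -
    let ?z = "chain_boundary (Suc p) c"
    have z: "singular_chain p X ?z" using singular_chain_boundary_alt[OF c] .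
    have "singular_chain (Suc p) X (frag_extend s ?z)"
      using z s(1) by (intro singular_chain_extend) (auto simp: singular_chain_def)
    moreover have "reduced_cycle p X ?z"
      by (rule reduced_cycle_boundary[OF c])
    ultimately show ?thesis
      using c by (simp add: reduced_cycle_def r'_def singular_cycle singular_chain_diff
          chain_boundary_diff bd[OF z] r(3))
  qed
  moreover have "r' z = z" if "reduced_cycle (Suc p) X z" for z
    using that by (simp add: reduced_cycle_def singular_cycle r'_def)
  moreover have "r' (a - b) = r' a - r' b" for a b
    by (simp add: r'_def chain_boundary_diff frag_extend_diff)
  ultimately show ?case by (intro exI[of _ r']) auto
qed

text \<open>
  The linear extension of a cochain to integral chains.
\<close>

definition cochain_eval :: "('a, 'k::field) cochain \<Rightarrow> 'a chain \<Rightarrow> 'k" where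
  "cochain_eval e c = (\<Sum>f\<in>Poly_Mapping.keys c. of_int (Poly_Mapping.lookup c f) * e f)"

lemma cochain_eval_superset:
  assumes "finite A" "Poly_Mapping.keys c \<subseteq> A"
  shows "cochain_eval e c = (\<Sum>f\<in>A. of_int (Poly_Mapping.lookup c f) * e f)"
  unfolding cochain_eval_def
  by (rule sum.mono_neutral_left) (use assms in \<open>auto simp: in_keys_iff\<close>)

lemma cochain_eval_frag_of: "cochain_eval e (frag_of f) = e f"
  by (simp add: cochain_eval_def)

lemma cochain_eval_diff: "cochain_eval e (a - b) = cochain_eval e a - cochain_eval e b"
proof -
  let ?A = "Poly_Mapping.keys a \<union> Poly_Mapping.keys b"
  have "Poly_Mapping.keys (a - b) \<subseteq> ?A" by (rule keys_diff)
  then show ?thesis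
    by (simp add: cochain_eval_superset[of ?A] lookup_minus left_diff_distrib sum_subtractf)
qed

lemma cochain_eval_0: "cochain_eval e 0 = 0"
  by (simp add: cochain_eval_def)

lemma cochain_eval_minus: "cochain_eval e (- a) = - cochain_eval e a"
  using cochain_eval_diff[of e 0 a] by (simp add: cochain_eval_0)

lemma cochain_eval_sum_signs:
  "cochain_eval e (\<Sum>k\<in>A. frag_cmul ((-1) ^ k) (frag_of (g k))) = (\<Sum>k\<in>A. (-1) ^ k * e (g k))"
proof (induction A rule: infinite_finite_induct)
  case (insert k A)
  have add: "cochain_eval e (a + b) = cochain_eval e a + cochain_eval e b" for a b
    using cochain_eval_diff[of e a "- b"] by (simp add: cochain_eval_minus)
  have "cochain_eval e (frag_cmul ((-1) ^ k) (frag_of (g k))) = (-1) ^ k * e (g k)"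
    by (cases "even k") (simp_all add: cochain_eval_frag_of cochain_eval_minus)
  then show ?case using insert by (simp add: add)
qed (simp_all add: cochain_eval_0)

lemma coboundary_eq_cochain_eval:
  assumes "singular_simplex (Suc p) X f"
  shows "coboundary (int p) X e f = cochain_eval e (chain_boundary (Suc p) (frag_of f))"
proof -
  have "{k. int k \<le> int p + 1} = {..Suc p}" "nat (int p + 1) = Suc p" by auto
  then show ?thesis
    using assms
    by (simp add: chain_boundary_of cochain_eval_sum_signs coboundary_def aug_simplex_set_def
        aug_face_def del: sum.atMost_Suc)
qed

text \<open>
  Compose the retraction \<open>r\<close> of chains onto reduced cycles with the class map to the integers and then
  with the map from the integers to the field. The resulting cochain vanishes on boundaries, hence is
  a cocycle, and it takes the value \<open>1\<close> on a cycle whose class generates the homology, whereas a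
  coboundary vanishes on every reduced cycle.
\<close>

lemma not_reduced_acyclic_of_integral_class:
  fixes X :: "'a topology"
  assumes low: "\<And>i. i < d \<Longrightarrow> trivial_group (reduced_homology_group (int i) X)"
    and top: "reduced_homology_group (int d) X \<cong> integer_group"
    and "topspace X \<noteq> {}"
  shows "\<not> reduced_acyclic TYPE('k::field) X"
proof
  assume acyclic: "reduced_acyclic TYPE('k) X"
  obtain r where r: "\<And>a b. r (a - b) = r a - r b" "\<And>c. singular_chain d X c \<Longrightarrow> reduced_cycle d X (r c)"
    "\<And>z. reduced_cycle d X z \<Longrightarrow> r z = z"
    using additive_retraction_onto_reduced_cycles[OF low \<open>topspace X \<noteq> {}\<close>] by metis
  let ?H = "reduced_homology_group (int d) X"
  obtain h where h: "h \<in> iso ?H integer_group" using top by (auto simp: is_iso_def)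
  interpret H: group_hom ?H integer_group h
    using h by (simp add: group_hom_def group_hom_axioms_def iso_def)
  define cl where "cl z = h (homologous_rel_set d X {} z)" for z
  have cl_add: "cl (a + b) = cl a + cl b" if "reduced_cycle d X a" "reduced_cycle d X b" for a b
    using that
    by (auto simp: cl_def homologous_rel_set_add carrier_reduced_homology_group_eq)
  have cl_diff: "cl (a - b) = cl a - cl b" if "reduced_cycle d X a" "reduced_cycle d X b" for a b
    using cl_add[of "a - b" b] that by (simp add: reduced_cycle_diff)
  have cl_boundary: "cl (chain_boundary (Suc d) c) = 0" if "singular_chain (Suc d) X c" for c
  proof -
    have "singular_relboundary d X {} (chain_boundary (Suc d) c)"
      using that by (auto simp: singular_boundary)
    then have "homologous_rel_set d X {} (chain_boundary (Suc d) c) = \<one>\<^bsub>?H\<^esub>"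
      by (simp add: homologous_rel_set_eq_relboundary one_reduced_homology_group)
    then show ?thesis
      using H.hom_one by (simp add: cl_def)
  qed
  have "(1::int) \<in> h ` carrier ?H"
    using h by (simp add: iso_def bij_betw_def)
  then obtain z where z: "reduced_cycle d X z" "cl z = 1"
    by (auto simp: carrier_reduced_homology_group_eq cl_def)
  then have zc: "singular_chain d X z" "chain_boundary d z = 0"
    by (auto simp: reduced_cycle_def singular_cycle)
  define \<phi> :: "('a, 'k) cochain" where
    "\<phi> = (\<lambda>f \<in> aug_simplex_set (int d) X. of_int (cl (r (frag_of f))))"
  have eval: "cochain_eval \<phi> c = of_int (cl (r c))" if c: "singular_chain d X c" for c
  proof -
    have "cochain_eval \<phi> c = of_int (cl (r c)) \<and> singular_chain d X c"
      using c unfolding singular_chain_def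
    proof (induction c rule: frag_induction)
      case zero
      then show ?case
        using cl_diff[of 0 0] r(1)[of 0 0] by (simp add: cochain_eval_0 reduced_cycle_def)
    next
      case (diff a b)
      then show ?case
        using keys_diff[of a b]
        by (auto simp: cochain_eval_diff r(1) cl_diff r(2) singular_chain_def)
    qed (simp add: cochain_eval_frag_of \<phi>_def aug_simplex_set_def)
    then show ?thesis by blast
  qed
  have "coboundary (int d) X \<phi> f = 0" if f: "singular_simplex (Suc d) X f" for f
  proof -
    have c: "singular_chain (Suc d) X (frag_of f)" using f by (simp add: singular_chain_of)
    show ?thesis
      using cl_boundary[OF c] r(3)[OF reduced_cycle_boundary[OF c]]
      by (simp add: coboundary_eq_cochain_eval[OF f] eval singular_chain_boundary_alt[OF c])
  qed
  then have "coboundary (int d) X \<phi> = \<one>\<^bsub>cochain_group (int d + 1) X\<^esub>"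
    by (auto simp: cochain_group_def aug_simplex_set_def coboundary_def fun_eq_iff nat_add_distrib
        restrict_def split: if_splits)
  then have "\<phi> \<in> cocycle_set (int d) X"
    by (simp add: cocycle_set_def kernel_def cochain_group_def \<phi>_def)
  moreover have "(cocycle_set (int d) X :: ('a, 'k) cochain set) = coboundary_set (int d) X"
    using acyclic by (simp add: reduced_acyclic_iff_cocycle_set_eq)
  ultimately obtain e where e: "\<phi> = coboundary (int d - 1) X e"
    by (auto simp: coboundary_set_def)
  have "cochain_eval \<phi> z = 0"
  proof (cases d)
    case 0
    (* Only the value of e on the empty simplex enters, so the coboundary is constant. *)
    let ?k = "\<lambda>_::(nat \<Rightarrow> real) \<Rightarrow> unit. e (\<lambda>_. undefined)"
    have "cochain_eval \<phi> z = cochain_eval ?k (chain_map 0 (\<lambda>_. ()) z)"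
      using zc(1)
    proof (rule chain_additive_eqI)
      fix f assume "singular_simplex d X f"
      then show "cochain_eval \<phi> (frag_of f) = cochain_eval ?k (chain_map 0 (\<lambda>_. ()) (frag_of f))"
        unfolding e using 0
        by (simp add: cochain_eval_frag_of coboundary_def aug_simplex_set_def aug_face_def)
    qed (simp_all add: cochain_eval_diff chain_map_diff)
    then show ?thesis
      using z(1) 0 by (simp add: cochain_eval_0 reduced_cycle_def)
  next
    case (Suc d')
    have "cochain_eval \<phi> z = cochain_eval e (chain_boundary d z)"
      using zc(1)
    proof (rule chain_additive_eqI)
      fix f assume "singular_simplex d X f"
      then show "cochain_eval \<phi> (frag_of f) = cochain_eval e (chain_boundary d (frag_of f))"
        unfolding e cochain_eval_frag_of using coboundary_eq_cochain_eval[of d' X f e] Suc by simp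
    qed (simp_all add: cochain_eval_diff chain_boundary_diff)
    then show ?thesis using zc by (simp add: cochain_eval_0)
  qed
  then show False
    using eval[OF zc(1)] r(3)[OF z(1)] z(2) by simp
qed

lemma not_reduced_acyclic_homeomorphic_nsphere:
  assumes X: "X homeomorphic_space nsphere d"
  shows "\<not> reduced_acyclic TYPE('k::field) X"
proof (rule not_reduced_acyclic_of_integral_class)
  have iso: "reduced_homology_group i X \<cong> reduced_homology_group i (nsphere d)" for i
    by (rule homeomorphic_space_imp_isomorphic_reduced_homology_groups[OF X])
  show "trivial_group (reduced_homology_group (int i) X)" if "i < d" for i
    using isomorphic_group_triviality[OF iso[of "int i"]] that
    by (simp add: trivial_reduced_homology_group_nsphere)
  show "reduced_homology_group (int d) X \<cong> integer_group"
    using iso_trans[OF iso reduced_homology_group_nsphere(1)] .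
  show "topspace X \<noteq> {}"
    using homeomorphic_empty_space[OF X] in_topspace_nsphere[of d] by auto
qed

section \<open>The retraction onto \<open>\<Xi>(g)\<close> when \<open>L\<close> meets the positive cone\<close>

lemma continuous_on_Min:
  fixes f :: "'i \<Rightarrow> 'a::topological_space \<Rightarrow> real"
  assumes "finite J" "J \<noteq> {}" "\<And>j. j \<in> J \<Longrightarrow> continuous_on A (f j)"
  shows "continuous_on A (\<lambda>x. Min ((\<lambda>j. f j x) ` J))"
  using assms
proof (induction J rule: finite_ne_induct)
  case (insert j J)
  then have "continuous_on A (\<lambda>x. min (f j x) (Min ((\<lambda>j. f j x) ` J)))"
    by (intro continuous_on_min) auto
  then show ?case using insert.hyps by simp
qed simp

definition sign_cone :: "('n::finite \<Rightarrow> int) \<Rightarrow> (real ^ 'n) set" where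
  "sign_cone g = {x. \<forall>j. of_int (g j) * x $ j \<ge> 0}"

lemma sign_cone_scaleR:
  assumes "x \<in> sign_cone g" "c \<ge> 0"
  shows "c *\<^sub>R x \<in> sign_cone g"
  using assms by (auto simp: sign_cone_def mult.left_commute[of _ c])

text \<open>
  The cone is pointed: it lies in a single closed orthant.
\<close>

lemma sign_cone_add_eq_0:
  assumes g: "range g \<subseteq> {-1, 1}" and "x \<in> sign_cone g" "y \<in> sign_cone g" "x + y = 0"
  shows "x = 0"
proof -
  have "x $ j = 0" for j
  proof -
    have "g j = 1 \<or> g j = -1" using g by auto
    moreover have "x $ j + y $ j = 0" using \<open>x + y = 0\<close> by (metis vector_add_component zero_index)
    moreover have "of_int (g j) * x $ j \<ge> 0" "of_int (g j) * y $ j \<ge> 0"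
      using assms(2,3) by (auto simp: sign_cone_def)
    ultimately show ?thesis by auto
  qed
  then show ?thesis by (simp add: vec_eq_iff)
qed

lemma convex_sign_cone_minus_0:
  fixes L :: "(real ^ 'n::finite) set"
  assumes L: "subspace L" and g: "range g \<subseteq> {-1, 1}"
  shows "convex (L \<inter> sign_cone g - {0})"
proof (rule convexI)
  fix x y :: "real ^ 'n" and a b :: real
  assume x: "x \<in> L \<inter> sign_cone g - {0}" and y: "y \<in> L \<inter> sign_cone g - {0}" and ab: "0 \<le> a" "0 \<le> b" "a + b = 1"
  note scale = sign_cone_scaleR[of _ g]
  have "a *\<^sub>R x + b *\<^sub>R y \<in> sign_cone g"
    using scale[of x a] scale[of y b] x y ab by (auto simp: sign_cone_def distrib_left)
  moreover have "a *\<^sub>R x + b *\<^sub>R y \<noteq> 0"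
  proof
    assume "a *\<^sub>R x + b *\<^sub>R y = 0"
    then have "a *\<^sub>R x = 0" "b *\<^sub>R y = 0"
      using sign_cone_add_eq_0[OF g, of "a *\<^sub>R x" "b *\<^sub>R y"] scale x y ab by auto
    then show False using x y ab by auto
  qed
  ultimately show "a *\<^sub>R x + b *\<^sub>R y \<in> L \<inter> sign_cone g - {0}"
    using x y L by (auto simp: subspace_add subspace_mul)
qed

definition Xi_set :: "(real ^ 'n) set \<Rightarrow> ('n::finite \<Rightarrow> int) \<Rightarrow> (real ^ 'n) set" where
  "Xi_set L g = {x \<in> L \<inter> sign_cone g. norm x = 1 \<and> (\<exists>j. g j = 1 \<and> x $ j = 0)}"

lemma Xi_eq: "Xi L g = top_of_set (Xi_set L g)"
  unfolding Xi_def Xi_set_def sign_cone_def spherical_simplex_def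
  by (rule arg_cong[of _ _ "subtopology euclidean"]) auto

text \<open>
  The number \<open>t x\<close> is the time at which the point moving from \<open>x\<close> in direction \<open>-p\<close> first meets a hyperplane
  \<open>x\<^sub>j = 0\<close> with \<open>g j = 1\<close>. It is continuous in \<open>x\<close>, as a minimum of finitely many linear functions, and is
  \<open>0\<close> on \<open>\<Xi>(g)\<close>. The coordinate \<open>m\<close>, where \<open>g m = -1\<close>, prevents the point from reaching the origin.
\<close>

lemma Xi_set_retract_of:
  fixes L :: "(real ^ 'n::finite) set"
  assumes L: "subspace L" and p: "p \<in> L" "p \<in> positive_cone"
    and g: "range g \<subseteq> {-1, 1}" "g k = 1" "g m = -1"
  shows "Xi_set L g retract_of (L \<inter> sign_cone g - {0})"
proof -
  let ?C = "L \<inter> sign_cone g - {0}" and ?J = "{j. g j = 1}"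
  have p_pos: "p $ j > 0" for j using p by (simp add: positive_cone_def)
  then have p_nz: "p $ j \<noteq> 0" for j by (metis less_irrefl)
  define t where "t x = Min ((\<lambda>j. x $ j / p $ j) ` ?J)" for x :: "real ^ 'n"
  have J: "finite ?J" "?J \<noteq> {}" using g by auto
  have t_le: "t x \<le> x $ j / p $ j" if "g j = 1" for x j
    unfolding t_def using that by (intro Min_le) auto
  have t_attained: "\<exists>j. g j = 1 \<and> t x = x $ j / p $ j" for x
  proof -
    have "t x \<in> (\<lambda>j. x $ j / p $ j) ` ?J"
      unfolding t_def using J by (intro Min_in) auto
    then show ?thesis by auto
  qed
  have t_nonneg: "t x \<ge> 0" if "x \<in> sign_cone g" for x
  proof -
    obtain j where j: "g j = 1" "t x = x $ j / p $ j" using t_attained by blast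
    have "of_int (g j) * x $ j \<ge> 0" using that by (simp add: sign_cone_def)
    then show ?thesis using j p_pos[of j] by simp
  qed
  define q where "q x = x - t x *\<^sub>R p" for x
  have q_cone: "q x \<in> sign_cone g" if x: "x \<in> sign_cone g" for x
  proof -
    have "of_int (g j) * q x $ j \<ge> 0" for j
    proof -
      have "of_int (g j) * x $ j \<ge> 0" using x by (simp add: sign_cone_def)
      moreover have "g j = 1 \<or> g j = -1" using g by auto
      moreover have "t x * p $ j \<le> x $ j" if "g j = 1"
        using t_le[OF that, of x] p_pos[of j] by (simp add: field_simps)
      moreover have "t x * p $ j \<ge> 0" using t_nonneg[OF x] p_pos[of j] by simp
      ultimately show ?thesis by (auto simp: q_def)
    qed
    then show ?thesis by (simp add: sign_cone_def)
  qed
  have q_nz: "q x \<noteq> 0" if x: "x \<in> ?C" for x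
  proof
    assume "q x = 0"
    then have xp: "x = t x *\<^sub>R p" by (simp add: q_def)
    then have "x $ m = t x * p $ m" by (metis vector_scaleR_component real_scaleR_def)
    moreover have "of_int (g m) * x $ m \<ge> 0" using x by (simp add: sign_cone_def)
    ultimately have "t x * p $ m \<le> 0" using g by simp
    then have "t x = 0" using t_nonneg[of x] x p_pos[of m] by (auto simp: mult_le_0_iff)
    then show False using xp x by simp
  qed
  have "continuous_on ?C t"
    unfolding t_def by (intro continuous_on_Min J continuous_intros) (simp add: p_nz)
  then have cont: "continuous_on ?C (\<lambda>x. sgn (q x))"
    unfolding sgn_div_norm using q_nz unfolding q_def by (intro continuous_intros) auto
  have "sgn (q x) \<in> Xi_set L g" if x: "x \<in> ?C" for x
  proof -
    obtain j where j: "g j = 1" "t x = x $ j / p $ j" using t_attained by blast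
    have "q x $ j = 0" using j p_pos[of j] by (simp add: q_def)
    moreover have "q x \<in> L" using x p L by (simp add: q_def subspace_diff subspace_mul)
    ultimately show ?thesis
      using q_cone[of x] q_nz[OF x] x j L
      by (auto simp: Xi_set_def norm_sgn sgn_div_norm sign_cone_def subspace_mul field_simps
          intro!: exI[of _ j])
  qed
  moreover have "sgn (q x) = x" if x: "x \<in> Xi_set L g" for x
  proof -
    obtain j where j: "g j = 1" "x $ j = 0" using x by (auto simp: Xi_set_def)
    have "t x = 0" using t_le[OF j(1), of x] t_nonneg[of x] x j by (auto simp: Xi_set_def)
    then show ?thesis using x by (simp add: q_def sgn_div_norm Xi_set_def)
  qed
  moreover have "Xi_set L g \<subseteq> ?C" by (auto simp: Xi_set_def)
  ultimately have "retraction ?C (Xi_set L g) (\<lambda>x. sgn (q x))"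
    using cont by (auto simp: retraction_def)
  then show ?thesis by (auto simp: retract_of_def)
qed

section \<open>A sign vector for which \<open>\<Xi>(g)\<close> is a sphere\<close>

text \<open>
  Coordinates are made nonzero one after the other: adding \<open>c w\<close> to \<open>x\<close> spoils a coordinate for at most one
  value of \<open>c\<close>.
\<close>

lemma subspace_point_off_coordinate_hyperplanes:
  fixes L :: "(real ^ 'n::finite) set"
  assumes L: "subspace L" and hyp: "\<And>j. \<not> L \<subseteq> {x. x $ j = 0}"
  obtains x where "x \<in> L" "\<And>j. x $ j \<noteq> 0"
proof -
  have "\<exists>x\<in>L. \<forall>j\<in>J. x $ j \<noteq> 0" if "finite J" for J
    using that
  proof (induction J)
    case empty
    then show ?case using subspace_0[OF L] by blast
  next
    case (insert k J)
    then obtain x where x: "x \<in> L" "\<forall>j\<in>J. x $ j \<noteq> 0" by blast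
    obtain w where w: "w \<in> L" "w $ k \<noteq> 0" using hyp[of k] by blast
    have "finite ((\<lambda>j. - x $ j / w $ j) ` insert k J)" using \<open>finite J\<close> by simp
    then obtain c where c: "c \<notin> (\<lambda>j. - x $ j / w $ j) ` insert k J"
      using ex_new_if_finite[OF infinite_UNIV_char_0[where 'a = real]] by blast
    have "(x + c *\<^sub>R w) $ j \<noteq> 0" if j: "j \<in> insert k J" for j
    proof (cases "w $ j = 0")
      case True
      then show ?thesis using j x w by auto
    next
      case False
      moreover have "c \<noteq> - x $ j / w $ j" using c j by blast
      ultimately show ?thesis by (auto simp: field_simps)
    qed
    moreover have "x + c *\<^sub>R w \<in> L" using x w L by (simp add: subspace_add subspace_mul)
    ultimately show ?case by blast
  qed
  from this[of UNIV] show ?thesis using that by auto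
qed

text \<open>
  If \<open>g\<close> has values \<open>1\<close> and \<open>-1\<close>, then this linear functional agrees with the \<open>l\<^sup>1\<close>-norm on the cone.
\<close>

definition signed_sum :: "('n::finite \<Rightarrow> int) \<Rightarrow> real ^ 'n \<Rightarrow> real" where
  "signed_sum g x = (\<Sum>j\<in>UNIV. of_int (g j) * x $ j)"

lemma signed_sum_linear:
  "signed_sum g (x + y) = signed_sum g x + signed_sum g y"
  "signed_sum g (x - y) = signed_sum g x - signed_sum g y"
  "signed_sum g (c *\<^sub>R x) = c * signed_sum g x"
  by (simp_all add: signed_sum_def sum.distrib sum_subtractf sum_distrib_left algebra_simps)

text \<open>
  Scale the interior point so that \<open>signed_sum g v = 1\<close>, and project \<open>L\<close> along \<open>v\<close> onto the kernel of
  \<open>signed_sum g\<close>, then normalize. A line parallel to \<open>v\<close> meets the boundary of the cone exactly once: going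
  in direction \<open>v\<close> from any point one enters the cone at some time and is in its interior ever after.
  This gives surjectivity, and also injectivity because the boundary is invariant under positive
  scaling. Compactness makes the inverse continuous.
\<close>

lemma sign_cone_boundary_homeomorphic_sphere:
  fixes L :: "(real ^ 'n::finite) set"
  assumes L: "subspace L" and v0: "v0 \<in> L" "\<And>j. of_int (g j) * v0 $ j > 0"
  shows "{y \<in> L \<inter> sign_cone g. norm y = 1 \<and> (\<exists>j. y $ j = 0)} homeomorphic
     sphere 0 1 \<inter> {w \<in> L. signed_sum g w = 0}"
proof -
  let ?s = "signed_sum g"
  let ?S = "{y \<in> L \<inter> sign_cone g. norm y = 1 \<and> (\<exists>j. y $ j = 0)}" and ?W = "{w \<in> L. ?s w = 0}"
  note s_lin = signed_sum_linear[of g]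
  have s_cont: "continuous_on A ?s" for A
    unfolding signed_sum_def by (intro continuous_intros)
  have s_nonneg: "?s y \<ge> 0" if "y \<in> sign_cone g" for y
    using that unfolding signed_sum_def sign_cone_def by (intro sum_nonneg) auto
  have s_v0: "?s v0 > 0"
    unfolding signed_sum_def using v0(2) by (intro sum_pos) auto
  define v where "v = v0 /\<^sub>R ?s v0"
  have v: "v \<in> L" "?s v = 1" "\<And>j. of_int (g j) * v $ j > 0"
    using v0 s_v0 L by (auto simp: v_def s_lin subspace_mul field_simps)
  have interior: "t \<le> 0" if yS: "y \<in> ?S" and y: "y = x + t *\<^sub>R v" and x: "x \<in> sign_cone g" for x y t
  proof (rule ccontr)
    assume "\<not> t \<le> 0"
    obtain j where j: "y $ j = 0" using yS by auto
    have "of_int (g j) * x $ j \<ge> 0" using x by (simp add: sign_cone_def)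
    moreover have "t * (of_int (g j) * v $ j) > 0"
      using v(3)[of j] \<open>\<not> t \<le> 0\<close> by (auto intro: mult_pos_pos[of t])
    ultimately have "of_int (g j) * x $ j + t * (of_int (g j) * v $ j) > 0"
      by (rule add_nonneg_pos)
    then have "of_int (g j) * y $ j > 0" using y by (simp add: algebra_simps)
    then show False using j by simp
  qed
  define \<pi> where "\<pi> y = y - ?s y *\<^sub>R v" for y
  have \<pi>_W: "\<pi> y \<in> ?W" if "y \<in> L" for y
    using that v L by (simp add: \<pi>_def s_lin subspace_diff subspace_mul)
  have \<pi>_nz: "\<pi> y \<noteq> 0" if y: "y \<in> ?S" for y
  proof
    assume "\<pi> y = 0"
    then have eq: "y = 0 + ?s y *\<^sub>R v" by (simp add: \<pi>_def)
    have "?s y \<le> 0" by (rule interior[OF y eq]) (simp add: sign_cone_def)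
    then have "?s y = 0" using s_nonneg[of y] y by simp
    then show False using eq y by simp
  qed
  have "compact ?S"
  proof -
    let ?F = "L \<inter> (\<Inter>j. {y. of_int (g j) * y $ j \<ge> 0}) \<inter> (\<Union>j. {y. y $ j = 0})"
    have "closed ?F"
      by (intro closed_Int closed_subspace[OF L] closed_INT ballI closed_UN finite
          closed_Collect_le closed_Collect_eq continuous_intros)
    moreover have "?S = sphere 0 1 \<inter> ?F"
      by (auto simp: sign_cone_def)
    ultimately show ?thesis
      by (simp only:) (rule compact_Int_closed[OF compact_sphere])
  qed
  moreover have "continuous_on ?S (\<lambda>y. sgn (\<pi> y))"
    unfolding sgn_div_norm using \<pi>_nz unfolding \<pi>_def by (intro continuous_intros s_cont) auto
  moreover have "(\<lambda>y. sgn (\<pi> y)) ` ?S = sphere 0 1 \<inter> ?W"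
  proof (intro equalityI subsetI)
    fix w assume "w \<in> (\<lambda>y. sgn (\<pi> y)) ` ?S"
    then obtain y where y: "y \<in> ?S" "w = sgn (\<pi> y)" by blast
    then show "w \<in> sphere 0 1 \<inter> ?W"
      using \<pi>_nz[OF y(1)] \<pi>_W[of y] L by (auto simp: norm_sgn sgn_div_norm s_lin subspace_mul)
  next
    fix w assume w: "w \<in> sphere 0 1 \<inter> ?W"
    define a where "a j = of_int (g j) * w $ j" for j
    define b where "b j = of_int (g j) * v $ j" for j
    have b: "b j > 0" for j using v(3) by (simp add: b_def)
    (* The least t for which w + t v lies in the cone. *)
    define t where "t = Max (range (\<lambda>j. - a j / b j))"
    have le: "a j + t * b j \<ge> 0" for j
    proof -
      have "- a j / b j \<le> t" unfolding t_def by (intro Max_ge) auto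
      then have "- a j \<le> t * b j" by (simp only: pos_divide_le_eq[OF b])
      then show ?thesis by simp
    qed
    have "t \<in> range (\<lambda>j. - a j / b j)" unfolding t_def by (intro Max_in) auto
    then obtain k where "t = - a k / b k" by blast
    then have k: "a k + t * b k = 0" using b[of k] by (simp add: field_simps)
    define y where "y = w + t *\<^sub>R v"
    have gy: "of_int (g j) * y $ j = a j + t * b j" for j
      by (simp add: y_def a_def b_def algebra_simps)
    have y: "y \<in> sign_cone g"
      using le by (simp add: sign_cone_def gy)
    have "g k \<noteq> 0" using b[of k] by (auto simp: b_def)
    then have yk: "y $ k = 0" using gy[of k] k by simp
    have sy: "?s y = t" using w v by (simp add: y_def s_lin)
    have "y \<noteq> 0"
    proof
      assume "y = 0"
      then have "t = 0" using sy by (simp add: signed_sum_def)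
      then show False using \<open>y = 0\<close> w by (simp add: y_def)
    qed
    have "sgn y \<in> ?S"
      using y yk \<open>y \<noteq> 0\<close> w v L
      by (auto simp: norm_sgn sgn_div_norm sign_cone_scaleR y_def subspace_add subspace_mul
          intro!: exI[of _ k])
    moreover have "\<pi> y = w" unfolding \<pi>_def sy by (simp add: y_def)
    then have "\<pi> (sgn y) = w /\<^sub>R norm y"
      by (simp add: \<pi>_def sgn_div_norm s_lin algebra_simps flip: \<open>\<pi> y = w\<close>)
    then have "w = sgn (\<pi> (sgn y))"
      using w \<open>y \<noteq> 0\<close> by (simp add: sgn_div_norm)
    ultimately show "w \<in> (\<lambda>y. sgn (\<pi> y)) ` ?S" by blast
  qed
  moreover have "inj_on (\<lambda>y. sgn (\<pi> y)) ?S"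
  proof (rule inj_onI)
    fix y z assume y: "y \<in> ?S" and z: "z \<in> ?S" and eq: "sgn (\<pi> y) = sgn (\<pi> z)"
    define c where "c = norm (\<pi> y) / norm (\<pi> z)"
    have c: "c > 0" using \<pi>_nz[OF y] \<pi>_nz[OF z] by (simp add: c_def)
    have "\<pi> y = norm (\<pi> y) *\<^sub>R sgn (\<pi> z)"
      using \<pi>_nz[OF y] unfolding eq[symmetric] by (simp add: sgn_div_norm)
    also have "\<dots> = c *\<^sub>R \<pi> z" by (simp add: sgn_div_norm c_def divide_inverse)
    finally have "\<pi> y = c *\<^sub>R \<pi> z" .
    define t where "t = ?s y - c * ?s z"
    have yz: "y = c *\<^sub>R z + t *\<^sub>R v"
      using \<open>\<pi> y = c *\<^sub>R \<pi> z\<close> by (simp add: \<pi>_def t_def algebra_simps)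
    have cone: "a *\<^sub>R x \<in> sign_cone g" if "x \<in> ?S" "a \<ge> 0" for a x
      using that by (simp add: sign_cone_scaleR)
    have "t \<le> 0" using interior[OF y yz cone[OF z]] c by simp
    moreover have "z = (1 / c) *\<^sub>R y + (- t / c) *\<^sub>R v"
      using c by (simp add: yz algebra_simps)
    from interior[OF z this cone[OF y]] have "t \<ge> 0" using c by (simp add: field_simps)
    ultimately have "y = c *\<^sub>R z" using yz by simp
    moreover have "norm y = 1" "norm z = 1" using y z by auto
    ultimately show "y = z" using c by simp
  qed
  ultimately show ?thesis
    by (rule homeomorphic_compact)
qed

text \<open>
  The vector \<open>v\<close> is chosen with as many positive coordinates as possible. If \<open>x\<close> is a boundary point all of
  whose vanishing coordinates have \<open>g j = -1\<close>, then for small \<open>e > 0\<close> the vector \<open>x - e v\<close> is positive at these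
  coordinates and has the sign of \<open>g j\<close> elsewhere, so it has more positive coordinates than \<open>v\<close>.
\<close>

lemma maximal_chamber:
  fixes L :: "(real ^ 'n::finite) set"
  assumes L: "subspace L" and hyp: "\<And>j. \<not> L \<subseteq> {x. x $ j = 0}"
  obtains g v where "range g \<subseteq> {-1, 1}" "v \<in> L" "\<And>j. of_int (g j) * v $ j > 0"
    "\<And>x i. x \<in> L \<inter> sign_cone g \<Longrightarrow> x $ i = 0 \<Longrightarrow> \<exists>j. g j = 1 \<and> x $ j = 0"
proof -
  obtain v1 where v1: "v1 \<in> L" "\<And>j. v1 $ j \<noteq> 0"
    using subspace_point_off_coordinate_hyperplanes[OF L hyp] by blast
  let ?P = "\<lambda>v. v \<in> L \<and> (\<forall>j. v $ j \<noteq> 0)" and ?N = "\<lambda>v::real ^ 'n. card {j. v $ j > 0}"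
  have "\<forall>v. ?P v \<longrightarrow> ?N v < Suc CARD('n)"
    by (simp add: card_mono less_Suc_eq_le)
  then obtain v where v: "v \<in> L" "\<And>j. v $ j \<noteq> 0" and max: "\<And>w. ?P w \<Longrightarrow> ?N w \<le> ?N v"
    using Lattices_Big.ex_has_greatest_nat[of ?P v1 ?N "Suc CARD('n)"] v1 by blast
  define g :: "'n \<Rightarrow> int" where "g j = (if v $ j > 0 then 1 else -1)" for j
  have gv: "of_int (g j) * v $ j > 0" for j using v(2)[of j] by (auto simp: g_def)
  have "\<exists>j. g j = 1 \<and> x $ j = 0" if x: "x \<in> L \<inter> sign_cone g" "x $ i = 0" for x i
  proof (rule ccontr)
    assume none: "\<not> (\<exists>j. g j = 1 \<and> x $ j = 0)"
    have "\<forall>\<^sub>F e in at_right 0. x $ j \<noteq> 0 \<longrightarrow> e * (of_int (g j) * v $ j) < of_int (g j) * x $ j" for j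
    proof (cases "x $ j = 0")
      case False
      have "of_int (g j) * x $ j \<ge> 0" using x by (simp add: sign_cone_def)
      then have "0 < of_int (g j) * x $ j" using False by (simp add: g_def split: if_splits)
      moreover have "((\<lambda>e. e * (of_int (g j) * v $ j)) \<longlongrightarrow> 0 * (of_int (g j) * v $ j)) (at_right 0)"
        by (intro tendsto_intros)
      ultimately show ?thesis by (auto dest: order_tendstoD(2) elim: eventually_mono)
    qed simp
    then have "\<forall>\<^sub>F e in at_right 0. \<forall>j. x $ j \<noteq> 0 \<longrightarrow> e * (of_int (g j) * v $ j) < of_int (g j) * x $ j"
      by (intro eventually_all_finite)
    then have "\<forall>\<^sub>F e in at_right 0. e > 0 \<and>
        (\<forall>j. x $ j \<noteq> 0 \<longrightarrow> e * (of_int (g j) * v $ j) < of_int (g j) * x $ j)"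
      using eventually_at_right_less[of "0::real"] by eventually_elim auto
    then obtain e :: real where e: "e > 0"
      "\<And>j. x $ j \<noteq> 0 \<Longrightarrow> e * (of_int (g j) * v $ j) < of_int (g j) * x $ j"
      by (auto dest!: eventually_happens)
    define w where "w = x - e *\<^sub>R v"
    have w: "of_int (g j) * w $ j > 0" if "x $ j \<noteq> 0" for j
      using e(2)[OF that] by (simp add: w_def algebra_simps)
    have w0: "w $ j > 0" if "x $ j = 0" for j
    proof -
      have "g j \<noteq> 1" using none that by blast
      then have "v $ j < 0" using v(2)[of j] by (cases "v $ j > 0") (auto simp: g_def)
      then show ?thesis using that e(1) by (simp add: w_def mult_pos_neg)
    qed
    have "w $ j \<noteq> 0" for j
      using w[of j] w0[of j] by (cases "x $ j = 0") auto
    moreover have "w \<in> L" using x v L by (simp add: w_def subspace_diff subspace_mul)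
    ultimately have "?P w" by blast
    moreover have "{j. v $ j > 0} \<subset> {j. w $ j > 0}"
    proof
      show "{j. v $ j > 0} \<subseteq> {j. w $ j > 0}"
      proof
        fix j assume "j \<in> {j. v $ j > 0}"
        then have "g j = 1" by (simp add: g_def)
        then show "j \<in> {j. w $ j > 0}" using w[of j] none by auto
      qed
      have "\<not> v $ i > 0" using none x(2) by (auto simp: g_def)
      then show "{j. v $ j > 0} \<noteq> {j. w $ j > 0}" using w0[OF x(2)] by blast
    qed
    then have "?N v < ?N w" by (intro psubset_card_mono) auto
    ultimately show False using max[of w] by simp
  qed
  moreover have "range g \<subseteq> {-1, 1}" by (auto simp: g_def)
  ultimately show ?thesis using that v(1) gv by blast
qed

section \<open>The equivalence\<close>

theorem theorem3p43:
  fixes L :: "(real ^ 'n::finite) set"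
  assumes "subspace L"
    and "dim L \<ge> 2"
    and "\<forall>j. \<not> L \<subseteq> {x. x $ j = 0}"
  shows "L \<inter> positive_cone \<noteq> {} \<longleftrightarrow>
    (\<forall>g :: 'n \<Rightarrow> int. range g \<subseteq> {-1, 1} \<and> g \<noteq> (\<lambda>_. 1) \<and> g \<noteq> (\<lambda>_. -1) \<longrightarrow>
       spherical_simplex g \<inter> L \<noteq> {} \<longrightarrow> reduced_acyclic TYPE('k::field) (Xi L g))"
proof
  note L = \<open>subspace L\<close>
  assume "L \<inter> positive_cone \<noteq> {}"
  then obtain p where p: "p \<in> L" "p \<in> positive_cone" by blast
  show "\<forall>g :: 'n \<Rightarrow> int. range g \<subseteq> {-1, 1} \<and> g \<noteq> (\<lambda>_. 1) \<and> g \<noteq> (\<lambda>_. -1) \<longrightarrow>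
       spherical_simplex g \<inter> L \<noteq> {} \<longrightarrow> reduced_acyclic TYPE('k::field) (Xi L g)"
  proof (intro allI impI)
    fix g :: "'n \<Rightarrow> int"
    assume g: "range g \<subseteq> {-1, 1} \<and> g \<noteq> (\<lambda>_. 1) \<and> g \<noteq> (\<lambda>_. -1)"
      and ne: "spherical_simplex g \<inter> L \<noteq> {}"
    have "g j = 1 \<or> g j = -1" for j using g by auto
    then obtain k m where "g k = 1" "g m = -1" using g by (metis ext)
    then have "Xi_set L g retract_of (L \<inter> sign_cone g - {0})"
      using Xi_set_retract_of[OF L p] g by blast
    moreover have "L \<inter> sign_cone g - {0} \<noteq> {}"
      using ne by (auto simp: spherical_simplex_def sign_cone_def)
    ultimately show "reduced_acyclic TYPE('k) (Xi L g)"
      unfolding Xi_eq using reduced_acyclic_retract_of_convex convex_sign_cone_minus_0[OF L] g by blast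
  qed
next
  note L = \<open>subspace L\<close>
  assume acyclic: "\<forall>g :: 'n \<Rightarrow> int. range g \<subseteq> {-1, 1} \<and> g \<noteq> (\<lambda>_. 1) \<and> g \<noteq> (\<lambda>_. -1) \<longrightarrow>
       spherical_simplex g \<inter> L \<noteq> {} \<longrightarrow> reduced_acyclic TYPE('k::field) (Xi L g)"
  show "L \<inter> positive_cone \<noteq> {}"
  proof
    assume disjoint: "L \<inter> positive_cone = {}"
    obtain g v where g: "range g \<subseteq> {-1, 1}" and v: "v \<in> L" "\<And>j. of_int (g j) * v $ j > 0"
      and boundary: "\<And>x i. x \<in> L \<inter> sign_cone g \<Longrightarrow> x $ i = 0 \<Longrightarrow> \<exists>j. g j = 1 \<and> x $ j = 0"
      using maximal_chamber[OF L] assms(3) by blast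
    have "g \<noteq> (\<lambda>_. 1)"
      using v disjoint by (auto simp: positive_cone_def)
    moreover have "g \<noteq> (\<lambda>_. -1)"
    proof
      assume "g = (\<lambda>_. -1)"
      then have "- v \<in> L \<inter> positive_cone"
        using v subspace_neg[OF L] by (simp add: positive_cone_def)
      then show False using disjoint by blast
    qed
    moreover have "spherical_simplex g \<inter> L \<noteq> {}"
    proof -
      have "v \<noteq> 0" using v(2) by (metis mult_zero_right less_irrefl zero_index)
      then have "sgn v \<in> spherical_simplex g \<inter> L"
        using v L by (auto simp: spherical_simplex_def norm_sgn sgn_div_norm subspace_mul
            mult.left_commute[of _ "inverse _"] less_imp_le)
      then show ?thesis by blast
    qed
    ultimately have "reduced_acyclic TYPE('k) (Xi L g)" using acyclic g by blast
    define W where "W = {w \<in> L. signed_sum g w = 0}"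
    have "subspace W"
      using L by (auto simp: W_def subspace_def signed_sum_linear) (simp add: signed_sum_def)
    have "Xi_set L g = {y \<in> L \<inter> sign_cone g. norm y = 1 \<and> (\<exists>j. y $ j = 0)}"
      using boundary by (auto simp: Xi_set_def)
    then have homeo: "Xi_set L g homeomorphic sphere 0 1 \<inter> W"
      using sign_cone_boundary_homeomorphic_sphere[OF L v] by (simp add: W_def)
    (* Otherwise L would be spanned by v, and the sphere in W would be empty. *)
    have "dim W \<noteq> 0"
    proof
      assume "dim W = 0"
      let ?s = "signed_sum g"
      have "?s v > 0" unfolding signed_sum_def using v(2) by (intro sum_pos) auto
      have "L \<subseteq> span {v}"
      proof
        fix x assume "x \<in> L"
        have "x - (?s x / ?s v) *\<^sub>R v \<in> W"
          using \<open>x \<in> L\<close> v(1) L \<open>?s v > 0\<close>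
          by (simp add: W_def subspace_diff subspace_mul signed_sum_linear)
        then have "x = (?s x / ?s v) *\<^sub>R v" using \<open>dim W = 0\<close> by auto
        then show "x \<in> span {v}" by (metis span_base span_mul singletonI)
      qed
      then have "dim L \<le> card {v}" by (intro dim_le_card) auto
      then show False using assms(2) by simp
    qed
    obtain B where B: "pairwise orthogonal B" "\<And>b. b \<in> B \<Longrightarrow> norm b = 1" "independent B"
      "card B = dim W" "span B = W"
      using orthonormal_basis_subspace[OF \<open>subspace W\<close>] by metis
    then obtain f h where "homeomorphic_maps (nsphere (dim W - 1)) (top_of_set (sphere 0 1 \<inter> W)) f h"
      using homeomorphic_maps_nsphere_euclidean_sphere[of B "dim W"] \<open>dim W \<noteq> 0\<close> by metis
    then have "top_of_set (sphere 0 1 \<inter> W) homeomorphic_space nsphere (dim W - 1)"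
      using homeomorphic_space_sym homeomorphic_space_def by blast
    moreover have "Xi L g homeomorphic_space top_of_set (sphere 0 1 \<inter> W)"
      using homeo by (simp add: Xi_eq)
    ultimately have "\<not> reduced_acyclic TYPE('k) (Xi L g)"
      using not_reduced_acyclic_homeomorphic_nsphere homeomorphic_space_trans by blast
    with \<open>reduced_acyclic TYPE('k) (Xi L g)\<close> show False by blast
  qed
qed

end
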